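(* For each $n\ge 3$, $\textsc{Bond}(C_n)$ is exactly the set of $x\in\mathbb{R}^{E(C_n)}$ satisfying the following inequalities, each of which is facet-defining for $\textsc{Bond}(C_n)$: $-x_e\le 0$ for each $e\in E(C_n)$; $x_e-\sum_{f\in E(C_n)\setminus\{e\}}x_f\le 0$ for each $e\in E(C_n)$; and $\sum_{e\in E(C_n)}x_e\le 2$.
   Context: $C_n$ is the cycle on $n$ vertices. For a graph $G=(V,E)$ and $S\subseteq V$, the cut $\delta(S)=\{e\in E:|e\cap S|=1\}$ is a bond if $G[S]$ and $G[V\setminus S]$ are connected. $x^\delta$ is the incidence vector, $\textsc{Bond}(G)=\mathrm{conv}\{x^\delta:\delta\text{ a bond}\}$.
   Formalization: That -x_e ≤ 0 is facet-defining is claimed only for n ≥ 4: for n = 3 it is false, since Bond(C_3) is a tetrahedron whose face x_e = 0 is only a segment; the empty cut is taken to be a bond, as the description requires. *)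

theory Defs
  imports "HOL-Analysis.Analysis"
begin

text \<open>
  A simple graph is given by a vertex set \<open>V\<close> and a set \<open>E\<close> of two-element subsets of \<open>V\<close>, over a
  finite type \<open>'v\<close>.  The space of real vectors indexed by \<open>E\<close> is the coordinate subspace
  \<open>edge_space E\<close> of \<open>real ^ ('v set)\<close>.
\<close>

definition cycle_graph :: "nat \<Rightarrow> 'v set \<Rightarrow> 'v set set \<Rightarrow> bool" where
  "cycle_graph n V E \<longleftrightarrow>
     (\<exists>c. bij_betw c {..<n} V \<and> E = (\<lambda>i. {c i, c (Suc i mod n)}) ` {..<n})"

text \<open>
  The graph induced on the empty set counts as connected.  Hence the empty cut of a connected graph
  is a bond, and the origin belongs to its bond polytope.
\<close>
definition induced_connected :: "'v set set \<Rightarrow> 'v set \<Rightarrow> bool" where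
  "induced_connected E S \<longleftrightarrow>
     (\<forall>u\<in>S. \<forall>v\<in>S. (u, v) \<in> {(a, b). a \<in> S \<and> b \<in> S \<and> {a, b} \<in> E}\<^sup>*)"

definition edge_cut :: "'v set set \<Rightarrow> 'v set \<Rightarrow> 'v set set" where
  "edge_cut E S = {e \<in> E. card (e \<inter> S) = 1}"

definition bonds :: "'v set \<Rightarrow> 'v set set \<Rightarrow> 'v set set set" where
  "bonds V E = {edge_cut E S | S. S \<subseteq> V \<and> induced_connected E S \<and> induced_connected E (V - S)}"

definition edge_space :: "'v::finite set set \<Rightarrow> (real ^ ('v set)) set" where
  "edge_space E = {x. \<forall>e. e \<notin> E \<longrightarrow> x $ e = 0}"

definition incidence_vector :: "'v::finite set set \<Rightarrow> real ^ ('v set)" where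
  "incidence_vector D = (\<chi> e. if e \<in> D then 1 else 0)"

definition bond_polytope :: "'v::finite set \<Rightarrow> 'v set set \<Rightarrow> (real ^ ('v set)) set" where
  "bond_polytope V E = convex hull (incidence_vector ` bonds V E)"

definition facet_defining :: "'a::euclidean_space set \<Rightarrow> ('a \<Rightarrow> real) \<Rightarrow> real \<Rightarrow> bool" where
  "facet_defining P f b \<longleftrightarrow>
     linear f \<and> (\<forall>x\<in>P. f x \<le> b) \<and> {x \<in> P. f x = b} facet_of P"

lemma cycle_graph_exists:
  assumes "n \<le> CARD('v::finite)"
  shows "\<exists>V E. cycle_graph n (V :: 'v set) E"
proof -
  obtain V :: "'v set" where "card V = n"
    using assms obtain_subset_with_card_n by metis
  then obtain c where "bij_betw c {..<n} V"
    using ex_bij_betw_nat_finite[of V] by (auto simp: atLeast0LessThan)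
  then show ?thesis by (auto simp: cycle_graph_def)
qed

text \<open>
  Nonnegativity constraints are not facet-defining for the triangle: its bond polytope is a
  tetrahedron, and the face where one coordinate vanishes is an edge of it.
\<close>
lemma nonneg_not_facet_defining_triangle:
  fixes V :: "'v::finite set"
  assumes "cycle_graph 3 V E" and "e \<in> E"
  shows "\<not> facet_defining (bond_polytope V E) (\<lambda>x. - x $ e) 0"
proof
  assume fd: "facet_defining (bond_polytope V E) (\<lambda>x. - x $ e) 0"
  let ?P = "bond_polytope V E" and ?F = "{x \<in> bond_polytope V E. - x $ e = 0}"
  have ex: "\<exists>a b c. a \<noteq> b \<and> b \<noteq> c \<and> a \<noteq> c \<and> V = {a, b, c} \<and> e = {a, b} \<and> E = {{a, b}, {b, c}, {c, a}}"
  proof -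
    obtain c where c: "bij_betw c {..<3} V" and E: "E = (\<lambda>i. {c i, c (Suc i mod 3)}) ` {..<3}"
      using assms(1) by (auto simp: cycle_graph_def)
    have S: "{..<3::nat} = {0, 1, 2}" by auto
    have V: "V = {c 0, c 1, c 2}" using c unfolding S bij_betw_def by simp
    have d: "c 0 \<noteq> c 1" "c 1 \<noteq> c 2" "c 0 \<noteq> c 2"
      using c unfolding S bij_betw_def inj_on_def by auto
    have E3: "E = {{c 0, c 1}, {c 1, c 2}, {c 2, c 0}}"
      unfolding E S by (simp add: numeral_2_eq_2)
    consider "e = {c 0, c 1}" | "e = {c 1, c 2}" | "e = {c 2, c 0}"
      using assms(2) E3 by auto
    then show ?thesis
    proof cases
      case 1
      then show ?thesis using d V E3 by (intro exI[of _ "c 0"] exI[of _ "c 1"] exI[of _ "c 2"]) auto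
    next
      case 2
      then show ?thesis using d V E3 by (intro exI[of _ "c 1"] exI[of _ "c 2"] exI[of _ "c 0"]) auto
    next
      case 3
      then show ?thesis using d V E3 by (intro exI[of _ "c 2"] exI[of _ "c 0"] exI[of _ "c 1"]) auto
    qed
  qed
  then obtain a b c where d: "a \<noteq> b" "b \<noteq> c" "a \<noteq> c" and V: "V = {a, b, c}"
    and e: "e = {a, b}" and E: "E = {{a, b}, {b, c}, {c, a}}" by blast
  define f where "f = {b, c}"
  define g where "g = {c, a}"
  have E': "E = {e, f, g}" using E e f_def g_def by simp
  have dis: "e \<noteq> f" "f \<noteq> g" "e \<noteq> g" using d unfolding e f_def g_def by (auto simp: doubleton_eq_iff)
  have par: "D = {} \<or> D = {e, f} \<or> D = {e, g} \<or> D = {f, g}" if DB: "D \<in> bonds V E" for D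
  proof -
    obtain S where S: "S \<subseteq> {a, b, c}" and D: "D = edge_cut E S"
      using DB V by (auto simp: bonds_def)
    have ce: "card (e \<inter> S) = 1 \<longleftrightarrow> (a \<in> S) \<noteq> (b \<in> S)"
      using d(1) unfolding e by (cases "a \<in> S"; cases "b \<in> S") auto
    have cf: "card (f \<inter> S) = 1 \<longleftrightarrow> (b \<in> S) \<noteq> (c \<in> S)"
      using d(2) unfolding f_def by (cases "b \<in> S"; cases "c \<in> S") auto
    have cg: "card (g \<inter> S) = 1 \<longleftrightarrow> (c \<in> S) \<noteq> (a \<in> S)"
      using d(3) unfolding g_def by (cases "c \<in> S"; cases "a \<in> S") auto
    have "D = {x \<in> {e, f, g}. card (x \<inter> S) = 1}" using D E' by (simp add: edge_cut_def)
    then show ?thesis using ce cf cg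
      by (cases "a \<in> S"; cases "b \<in> S"; cases "c \<in> S") auto
  qed
  have conn: "induced_connected E S" if "S \<subseteq> V" for S
  proof -
    have "{u, v} \<in> E" if "u \<in> S" "v \<in> S" "u \<noteq> v" for u v
      using that \<open>S \<subseteq> V\<close> V E by (auto simp: insert_commute)
    then show ?thesis unfolding induced_connected_def
      by (metis (mono_tags, lifting) case_prodI mem_Collect_eq r_into_rtrancl rtrancl.rtrancl_refl)
  qed
  have cutb: "edge_cut E S \<in> bonds V E" if "S \<subseteq> V" for S
    using conn[of S] conn[of "V - S"] that by (auto simp: bonds_def)
  have c0: "edge_cut E {} = {}" by (simp add: edge_cut_def)
  have ca: "edge_cut E {a} = {e, g}" and cb: "edge_cut E {b} = {e, f}" and cc: "edge_cut E {c} = {f, g}"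
    using d E' by (auto simp: edge_cut_def e f_def g_def)
  have inP: "incidence_vector {} \<in> ?P" "incidence_vector {e, g} \<in> ?P"
    "incidence_vector {e, f} \<in> ?P" "incidence_vector {f, g} \<in> ?P"
    using cutb[of "{}"] cutb[of "{a}"] cutb[of "{b}"] cutb[of "{c}"] V
    unfolding c0 ca cb cc bond_polytope_def by (auto intro!: hull_inc)
  have zero: "incidence_vector {} = (0 :: real ^ ('v set))"
    by (simp add: incidence_vector_def vec_eq_iff)
  let ?A = "\<lambda>h. axis h (1::real) :: real ^ ('v set)"
  have sp: "?A e \<in> span ?P" "?A f \<in> span ?P" "?A g \<in> span ?P"
  proof -
    let ?u = "incidence_vector {e, f}" and ?v = "incidence_vector {e, g}" and ?w = "incidence_vector {f, g}"
    have m: "?u \<in> span ?P" "?v \<in> span ?P" "?w \<in> span ?P" using inP by (auto intro: span_base)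
    have "?A e = (1/2) *\<^sub>R (?u + ?v - ?w)" "?A f = (1/2) *\<^sub>R (?u + ?w - ?v)" "?A g = (1/2) *\<^sub>R (?v + ?w - ?u)"
      using dis by (auto simp: vec_eq_iff incidence_vector_def axis_def)
    then show "?A e \<in> span ?P" "?A f \<in> span ?P" "?A g \<in> span ?P"
      using m by (auto intro!: span_scale span_add span_diff)
  qed
  have ind: "independent {?A e, ?A f, ?A g}"
    by (rule independent_mono[OF independent_Basis]) (auto simp: Basis_vec_def)
  have "card {?A e, ?A f, ?A g} = 3" using dis by (simp add: axis_eq_axis)
  then have dP: "dim ?P \<ge> 3"
    using independent_card_le_dim[of "{?A e, ?A f, ?A g}" "span ?P"] ind sp by simp
  have aP: "aff_dim ?P \<ge> 3"
    using aff_dim_zero[of ?P] dP inP(1) zero by (simp add: hull_inc)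
  let ?w = "incidence_vector {f, g}"
  let ?Q = "{x :: real ^ ('v set). x $ f - x $ g - x $ e \<le> 0} \<inter> {x. x $ g - x $ f - x $ e \<le> 0} \<inter> {x. \<forall>h. h \<notin> E \<longrightarrow> x $ h = 0}"
  have "convex ?Q"
  proof -
    have c1: "convex {x :: real ^ ('v set). x $ f - x $ g - x $ e \<le> 0}"
      using convex_halfspace_le[of "?A f - ?A g - ?A e" 0] by (simp add: inner_diff_left inner_axis')
    have c2: "convex {x :: real ^ ('v set). x $ g - x $ f - x $ e \<le> 0}"
      using convex_halfspace_le[of "?A g - ?A f - ?A e" 0] by (simp add: inner_diff_left inner_axis')
    have c3: "convex {x :: real ^ ('v set). \<forall>h. h \<notin> E \<longrightarrow> x $ h = 0}"
      by (auto simp: convex_def)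
    show ?thesis by (intro convex_Int c1 c2 c3)
  qed
  moreover have "incidence_vector ` bonds V E \<subseteq> ?Q"
  proof
    fix x assume "x \<in> incidence_vector ` bonds V E"
    then obtain D where x: "x = incidence_vector D" and "D \<in> bonds V E" by blast
    from par[OF this(2)] consider "D = {}" | "D = {e, f}" | "D = {e, g}" | "D = {f, g}" by blast
    then show "x \<in> ?Q" using dis E' x by cases (auto simp: incidence_vector_def)
  qed
  ultimately have PQ: "?P \<subseteq> ?Q" unfolding bond_polytope_def by (intro hull_minimal)
  have "?F \<subseteq> span {?w}"
  proof
    fix x assume x: "x \<in> ?F"
    then have xP: "x \<in> ?P" and xe: "x $ e = 0" by simp_all
    have xQ: "x \<in> ?Q" using PQ xP by (rule subsetD)
    then have "x $ f - x $ g - x $ e \<le> 0" "x $ g - x $ f - x $ e \<le> 0" by simp_all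
    then have xg: "x $ g = x $ f" using xe by linarith
    have xo: "x $ h = 0" if "h \<notin> E" for h using xQ that by blast
    have "x $ h = ((x $ f) *\<^sub>R ?w) $ h" for h
    proof (cases "h \<in> E")
      case True
      then consider "h = e" | "h = f" | "h = g" using E' by blast
      then show ?thesis using dis xe xg by cases (simp_all add: incidence_vector_def)
    next
      case False
      then show ?thesis using xo[of h] E' by (simp add: incidence_vector_def)
    qed
    then have eq: "x = (x $ f) *\<^sub>R ?w" by (intro vec_eq_iff[THEN iffD2] allI)
    have "(x $ f) *\<^sub>R ?w \<in> span {?w}" by (intro span_scale span_base) simp
    then show "x \<in> span {?w}" by (subst eq)
  qed
  then have "aff_dim ?F \<le> aff_dim (span {?w})" by (rule aff_dim_subset)
  also have "\<dots> = int (dim {?w})" by (simp add: aff_dim_subspace)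
  also have "\<dots> \<le> 1" using dim_le_card'[of "{?w}"] by simp
  finally have "aff_dim ?F \<le> 1" .
  moreover have "aff_dim ?F = aff_dim ?P - 1"
    using fd by (simp add: facet_defining_def facet_of_def)
  ultimately show False using aP by simp
qed

end

theory Submission
  imports Defs
begin

text \<open>
  A connected set of vertices of a cycle with connected complement is an arc, so the bonds of a cycle
  are the empty set and all pairs of edges.  The bond polytope is therefore the cone, truncated at
  coordinate sum 2, over the hypersimplex of all vectors in the unit cube with coordinate sum 2,
  whose extreme points are integral.  For each inequality, the pairs of edges satisfying it with
  equality, together with one further point of the polytope, span the whole edge space; as the origin
  is among the points considered, this gives a face of codimension one.
\<close>

section \<open>Bonds of a cycle\<close>

lemma card_edge_Int:
  assumes "u \<noteq> v"
  shows "card ({u, v} \<inter> S) = Suc 0 \<longleftrightarrow> (u \<in> S) \<noteq> (v \<in> S)"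
  using assms by (cases "u \<in> S"; cases "v \<in> S") auto

text \<open>The labelling is a parameter, so that one and the same cycle can be interpreted again
  under a labelling better suited to a given edge.\<close>

locale cycle_labelling =
  fixes n :: nat and c :: "nat \<Rightarrow> 'v" and V :: "'v set" and E :: "'v set set"
  assumes n3: "n \<ge> 3" and bij: "bij_betw c {..<n} V"
    and E: "E = (\<lambda>i. {c i, c (Suc i mod n)}) ` {..<n}"
begin

lemma c_eq_iff: "i < n \<Longrightarrow> j < n \<Longrightarrow> c i = c j \<longleftrightarrow> i = j"
  using bij by (auto simp: bij_betw_def inj_on_def)

lemma V_eq: "V = c ` {..<n}"
  using bij by (simp add: bij_betw_def)

lemma edge_cases:
  assumes "e \<in> E"
  obtains "e = {c (n - 1), c 0}" | i where "Suc i < n" "e = {c i, c (Suc i)}"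
proof -
  obtain i where i: "i < n" "e = {c i, c (Suc i mod n)}"
    using assms E by auto
  show ?thesis
  proof (cases "Suc i < n")
    case True
    then show ?thesis using i that(2) by simp
  next
    case False
    then have "Suc i = n" using i by simp
    then have "i = n - 1" "Suc i mod n = 0" by auto
    then show ?thesis using i that(1) by simp
  qed
qed

lemma last_edge: "{c (n - 1), c 0} \<in> E"
  using n3 unfolding E by (intro image_eqI[of _ _ "n - 1"]) auto

lemma path_edge: "Suc i < n \<Longrightarrow> {c i, c (Suc i)} \<in> E"
  unfolding E by (intro image_eqI[of _ _ i]) auto

lemma card_edges: "card E = n"
proof -
  have "inj_on (\<lambda>i. {c i, c (Suc i mod n)}) {..<n}"
  proof (rule inj_onI)
    fix i j assume i: "i \<in> {..<n}" and j: "j \<in> {..<n}"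
      and eq: "{c i, c (Suc i mod n)} = {c j, c (Suc j mod n)}"
    have m: "Suc i mod n < n" "Suc j mod n < n" using n3 by auto
    \<comment> \<open>In the second alternative each index is the cyclic successor of the other, so
      \<open>n\<close> divides 2, against \<open>n3\<close>.\<close>
    have "i = j \<or> (i = Suc j mod n \<and> j = Suc i mod n)"
      using eq i j m by (auto simp: doubleton_eq_iff c_eq_iff)
    then show "i = j"
      using i j n3 by (auto simp: mod_Suc split: if_splits)
  qed
  then show ?thesis unfolding E by (simp add: card_image)
qed

text \<open>By symmetry any edge may be taken as the closing edge of the labelling. Arcs that end at
  this edge then become initial or final intervals of indices.\<close>

lemma rotate:
  assumes "e \<in> E"
  obtains c' where "cycle_labelling n c' V E" "e = {c' (n - 1), c' 0}"
proof -
  obtain i where i: "i < n" "e = {c i, c (Suc i mod n)}"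
    using assms E by auto
  \<comment> \<open>The shift by \<open>Suc i\<close> takes \<open>n - 1\<close> to \<open>i\<close>
    and \<open>0\<close> to the successor of \<open>i\<close>, the two ends of
    \<open>e\<close>.\<close>
  define r where "r k = (k + Suc i) mod n" for k
  have inj: "inj_on r {..<n}"
  proof (rule inj_onI)
    fix k l assume k: "k \<in> {..<n}" and l: "l \<in> {..<n}" and eq: "r k = r l"
    have "(k + Suc i) mod n = (if k + Suc i < n then k + Suc i else k + Suc i - n)"
      "(l + Suc i) mod n = (if l + Suc i < n then l + Suc i else l + Suc i - n)"
      using k l i by (auto simp: mod_if)
    then show "k = l" using eq k l i unfolding r_def by (auto split: if_splits)
  qed
  have "r ` {..<n} \<subseteq> {..<n}" using n3 by (auto simp: r_def)
  then have surj: "r ` {..<n} = {..<n}" using inj by (simp add: endo_inj_surj)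
  have rb: "bij_betw r {..<n} {..<n}" using inj surj by (simp add: bij_betw_def)
  have rs: "r (Suc k mod n) = Suc (r k) mod n" for k
    unfolding r_def by (simp only: mod_add_left_eq mod_Suc_eq add_Suc)
  have "E = (\<lambda>i. {c i, c (Suc i mod n)}) ` r ` {..<n}" using E surj by simp
  also have "\<dots> = (\<lambda>k. {(c \<circ> r) k, (c \<circ> r) (Suc k mod n)}) ` {..<n}"
    by (simp add: image_image rs)
  finally have "cycle_labelling n (c \<circ> r) V E"
    using n3 bij_betw_trans[OF rb bij] by unfold_locales
  moreover have "r (n - 1) = i" "r 0 = Suc i mod n"
    using i n3 by (auto simp: r_def)
  ultimately show thesis using that[of "c \<circ> r"] i by simp
qed

text \<open>Path edges lead from \<open>c a\<close> up to each vertex of the interval, and adjacency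
  is symmetric, so any two vertices are joined through \<open>c a\<close>.\<close>

lemma induced_connected_interval:
  assumes "b \<le> n"
  shows "induced_connected E (c ` {a..<b})"
proof -
  define R where "R = {(u, v). u \<in> c ` {a..<b} \<and> v \<in> c ` {a..<b} \<and> {u, v} \<in> E}"
  have "sym R" unfolding R_def sym_def by (auto simp: insert_commute)
  then have symR: "sym (R\<^sup>*)" by (rule sym_rtrancl)
  have up: "k < b \<longrightarrow> (c a, c k) \<in> R\<^sup>*" if "a \<le> k" for k
    using that
  proof (induction k rule: dec_induct)
    case (step k)
    show ?case
    proof
      assume k: "Suc k < b"
      then have "(c k, c (Suc k)) \<in> R"
        using step assms path_edge[of k] by (auto simp: R_def)
      then show "(c a, c (Suc k)) \<in> R\<^sup>*" using step k by (auto intro: rtrancl_into_rtrancl)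
    qed
  qed simp
  have "(c k, c l) \<in> R\<^sup>*" if "k \<in> {a..<b}" "l \<in> {a..<b}" for k l
    using that up[of k] up[of l] symD[OF symR] by (metis atLeastLessThan_iff rtrancl_trans)
  then show ?thesis
    unfolding induced_connected_def R_def[symmetric] by blast
qed

text \<open>Every edge has two distinct ends, both in \<open>V\<close>. This allows the side of a
  bond that contains a prescribed vertex to be chosen.\<close>

lemma edge_cut_complement: "edge_cut E (V - S) = edge_cut E S"
proof -
  have "card (e \<inter> (V - S)) = 1 \<longleftrightarrow> card (e \<inter> S) = 1" if "e \<in> E" for e
    using that
  proof (cases rule: edge_cases)
    case 1
    then show ?thesis using n3 c_eq_iff[of "n - 1" 0]
      by (auto simp: V_eq card_edge_Int)
  next
    case (2 i)
    then show ?thesis using c_eq_iff[of i "Suc i"]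
      by (auto simp: V_eq card_edge_Int)
  qed
  then show ?thesis by (auto simp: edge_cut_def)
qed

text \<open>Along the path, membership changes only between \<open>j - 1\<close> and
  \<open>j\<close>; the closing edge joins the outside vertex \<open>c (n - 1)\<close> to the inside
  vertex \<open>c 0\<close>.\<close>

lemma edge_cut_initial_interval:
  assumes "0 < j" "j < n"
  shows "edge_cut E (c ` {..<j}) = {{c (j - 1), c j}, {c (n - 1), c 0}}"
proof -
  have mem: "c k \<in> c ` {..<j} \<longleftrightarrow> k < j" if "k < n" for k
    using that assms by (auto simp: c_eq_iff)
  have last: "card ({c (n - 1), c 0} \<inter> c ` {..<j}) = 1"
    using n3 assms c_eq_iff[of "n - 1" 0] mem[of "n - 1"] mem[of 0]
    by (auto simp: card_edge_Int)
  have path: "card ({c i, c (Suc i)} \<inter> c ` {..<j}) = 1 \<longleftrightarrow> Suc i = j" if "Suc i < n" for i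
    using that assms c_eq_iff[of i "Suc i"] mem[of i] mem[of "Suc i"]
    by (auto simp: card_edge_Int)
  show ?thesis
  proof (intro equalityI subsetI)
    fix e assume "e \<in> edge_cut E (c ` {..<j})"
    then have e: "e \<in> E" "card (e \<inter> c ` {..<j}) = 1" by (auto simp: edge_cut_def)
    from e(1) show "e \<in> {{c (j - 1), c j}, {c (n - 1), c 0}}"
      using e(2) path by (cases rule: edge_cases) auto
  next
    fix e assume "e \<in> {{c (j - 1), c j}, {c (n - 1), c 0}}"
    then show "e \<in> edge_cut E (c ` {..<j})"
      using last path[of "j - 1"] last_edge path_edge[of "j - 1"] assms
      by (auto simp: edge_cut_def)
  qed
qed

text \<open>Let \<open>j\<close> be the first index outside \<open>S\<close>. Within
  \<open>S\<close> no edge leaves the vertices below \<open>j\<close>: the step up from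
  \<open>j - 1\<close> reaches \<open>c j\<close>, and the closing edge reaches
  \<open>c (n - 1)\<close>, both outside \<open>S\<close>. Connectedness then leaves nothing else in
  \<open>S\<close>.\<close>

lemma connected_initial_interval:
  assumes "S \<subseteq> V" "induced_connected E S" "c 0 \<in> S" "c (n - 1) \<notin> S"
  obtains j where "0 < j" "j < n" "S = c ` {..<j}"
proof -
  define j where "j = (LEAST k. c k \<notin> S)"
  have jS: "c j \<notin> S" unfolding j_def using assms(4) by (rule LeastI)
  have below: "c k \<in> S" if "k < j" for k
    using that not_less_Least unfolding j_def by blast
  have "j \<le> n - 1" unfolding j_def using assms(4) by (rule Least_le)
  then have jn: "j < n" using n3 by simp
  have j0: "0 < j" using jS assms(3) by (cases j) auto
  define R where "R = {(u, v). u \<in> S \<and> v \<in> S \<and> {u, v} \<in> E}"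
  have closed: "v \<in> c ` {..<j}" if u: "u \<in> c ` {..<j}" and uv: "(u, v) \<in> R" for u v
  proof -
    obtain k where k: "k < j" "u = c k" using u by auto
    have v: "v \<in> S" "{u, v} \<in> E" using uv by (auto simp: R_def)
    from v(2) show ?thesis
    proof (cases rule: edge_cases)
      case 1
      then show ?thesis using v(1) k assms(4) below j0 by (auto simp: doubleton_eq_iff)
    next
      case (2 i)
      note path = 2
      then consider "u = c i" "v = c (Suc i)" | "u = c (Suc i)" "v = c i"
        by (auto simp: doubleton_eq_iff)
      then show ?thesis
      proof cases
        case 1
        then have "i = k" using k path jn c_eq_iff[of i k] by simp
        then have "Suc i \<noteq> j" "Suc i \<le> j" using 1 v(1) jS k by auto
        then show ?thesis using 1 by auto
      next
        case 2
        then have "Suc i = k" using k path jn c_eq_iff[of "Suc i" k] by simp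
        then show ?thesis using 2 k by auto
      qed
    qed
  qed
  have "S \<subseteq> c ` {..<j}"
  proof
    fix v assume "v \<in> S"
    then have "(c 0, v) \<in> R\<^sup>*"
      using assms(2,3) unfolding induced_connected_def R_def by blast
    then show "v \<in> c ` {..<j}"
      by (induction rule: rtrancl_induct) (use j0 closed in auto)
  qed
  then show thesis using that j0 jn below by blast
qed

text \<open>Rotate so that some edge of the cut closes the cycle, and pass to the complement if
  needed so that the side contains \<open>c' 0\<close>. This side is an initial interval, whose cut
  is known.\<close>

lemma card_bond:
  assumes "D \<in> bonds V E" "D \<noteq> {}"
  shows "card D = 2"
proof -
  obtain S where S: "S \<subseteq> V" "induced_connected E S" "induced_connected E (V - S)"
    and D: "D = edge_cut E S"
    using assms(1) by (auto simp: bonds_def)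
  obtain e where e: "e \<in> E" "card (e \<inter> S) = 1" using assms(2) D by (auto simp: edge_cut_def)
  obtain c' where cl: "cycle_labelling n c' V E" and e': "e = {c' (n - 1), c' 0}"
    using rotate[OF e(1)] .
  interpret L: cycle_labelling n c' V E by fact
  have ne: "c' (n - 1) \<noteq> c' 0" using n3 L.c_eq_iff[of "n - 1" 0] by simp
  have inV: "c' 0 \<in> V" "c' (n - 1) \<in> V" using n3 by (auto simp: L.V_eq)
  obtain T where T: "T \<subseteq> V" "induced_connected E T" "c' 0 \<in> T" "c' (n - 1) \<notin> T"
    and DT: "D = edge_cut E T"
  proof (cases "c' 0 \<in> S")
    case True
    then show ?thesis using that[of S] S D e(2) ne e' by (auto simp: card_edge_Int)
  next
    case False
    then show ?thesis using that[of "V - S"] S D e(2) ne e' inV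
      by (auto simp: card_edge_Int edge_cut_complement)
  qed
  obtain j where j: "0 < j" "j < n" "T = c' ` {..<j}"
    using L.connected_initial_interval[OF T] .
  have "D = {{c' (j - 1), c' j}, {c' (n - 1), c' 0}}"
    using L.edge_cut_initial_interval[OF j(1,2)] DT j(3) by simp
  \<comment> \<open>Equality would force \<open>j = 1\<close> and \<open>j = n - 1\<close>, hence
    \<open>n = 2\<close>.\<close>
  moreover have "{c' (j - 1), c' j} \<noteq> {c' (n - 1), c' 0}"
    using j n3 by (auto simp: doubleton_eq_iff L.c_eq_iff)
  ultimately show ?thesis by simp
qed

text \<open>With \<open>e\<close> as closing edge, removing \<open>f\<close> splits the remaining
  path into an initial and a final interval, both connected.\<close>

lemma pair_bond:
  assumes "e \<in> E" "f \<in> E" "e \<noteq> f"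
  shows "{e, f} \<in> bonds V E"
proof -
  obtain c' where cl: "cycle_labelling n c' V E" and e': "e = {c' (n - 1), c' 0}"
    using rotate[OF assms(1)] .
  interpret L: cycle_labelling n c' V E by fact
  from assms(2) obtain i where i: "Suc i < n" "f = {c' i, c' (Suc i)}"
    using assms(3) e' by (cases rule: L.edge_cases) auto
  let ?S = "c' ` {..<Suc i}"
  have "V - ?S = c' ` {Suc i..<n}"
    using i inj_on_image_set_diff[of c' "{..<n}" "{..<n}" "{..<Suc i}"] L.bij
    by (simp add: L.V_eq bij_betw_def ivl_diff flip: atLeast0LessThan)
  then have "induced_connected E (V - ?S)"
    using L.induced_connected_interval[of n "Suc i"] by simp
  moreover have "induced_connected E ?S"
    using L.induced_connected_interval[of "Suc i" 0] i by (simp only: atLeast0LessThan)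
  moreover have "?S \<subseteq> V" using i by (auto simp: L.V_eq)
  moreover have "{e, f} = edge_cut E ?S"
    using L.edge_cut_initial_interval[of "Suc i"] i e' by (auto simp del: lessThan_Suc)
  ultimately show ?thesis unfolding bonds_def by blast
qed

lemma empty_bond: "{} \<in> bonds V E"
proof -
  have "induced_connected E (V - {})"
    using induced_connected_interval[of n 0] by (simp only: V_eq atLeast0LessThan Diff_empty)
  moreover have "induced_connected E {}" by (simp add: induced_connected_def)
  moreover have "{} = edge_cut E {}" by (simp add: edge_cut_def)
  ultimately show ?thesis unfolding bonds_def by blast
qed

lemma bonds_eq: "bonds V E = insert {} {D. D \<subseteq> E \<and> card D = 2}"
proof (intro equalityI subsetI)
  fix D assume "D \<in> bonds V E"
  moreover have "D \<subseteq> E" using \<open>D \<in> bonds V E\<close> by (auto simp: bonds_def edge_cut_def)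
  ultimately show "D \<in> insert {} {D. D \<subseteq> E \<and> card D = 2}" using card_bond by blast
next
  fix D assume "D \<in> insert {} {D. D \<subseteq> E \<and> card D = 2}"
  then show "D \<in> bonds V E" using pair_bond empty_bond by (auto simp: card_2_iff)
qed

end

section \<open>The convex hull of the vectors with two unit entries\<close>

definition pair_vectors :: "'v::finite set set \<Rightarrow> (real ^ ('v set)) set" where
  "pair_vectors E = incidence_vector ` {D. D \<subseteq> E \<and> card D = 2}"

text \<open>The second hypersimplex on the coordinates in \<open>E\<close>, described by
  inequalities; its extreme points will turn out to lie in \<open>pair_vectors E\<close>.\<close>

definition hypersimplex2 :: "'v::finite set set \<Rightarrow> (real ^ ('v set)) set" where
  "hypersimplex2 E = edge_space E \<inter> cbox 0 1 \<inter> {x. (\<Sum>e\<in>E. x $ e) = 2}"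

lemma convex_edge_space: "convex (edge_space E)"
  by (auto simp: edge_space_def convex_def)

lemma sum_incidence_vector:
  fixes E :: "'v::finite set set"
  assumes "D \<subseteq> E"
  shows "(\<Sum>e\<in>E. incidence_vector D $ e) = card D"
proof -
  have "{e \<in> E. e \<in> D} = D" using assms by auto
  then show ?thesis by (simp add: incidence_vector_def flip: sum.inter_filter)
qed

lemma linear_component_sum: "linear (\<lambda>x :: real ^ 'i::finite. \<Sum>e\<in>E. x $ e)"
  by (intro linearI) (auto simp: sum.distrib sum_distrib_left)

lemma compact_hypersimplex2: "compact (hypersimplex2 E)"
proof -
  have "closed (edge_space E)"
  proof -
    have "edge_space E = (\<Inter>e\<in>-E. {x. x $ e = 0})" by (auto simp: edge_space_def)
    moreover have "closed {x :: real ^ ('a set). x $ e = 0}" for e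
      by (intro closed_Collect_eq continuous_intros)
    ultimately show ?thesis by auto
  qed
  moreover have "closed {x :: real ^ ('a set). (\<Sum>e\<in>E. x $ e) = 2}"
    by (intro closed_Collect_eq continuous_intros)
  ultimately show ?thesis unfolding hypersimplex2_def
    by (intro compact_Int_closed closed_Int_compact compact_cbox) auto
qed

lemma convex_hypersimplex2: "convex (hypersimplex2 E)"
proof -
  have "convex ((\<lambda>x :: real ^ ('a set). \<Sum>e\<in>E. x $ e) -` {2})"
    by (intro convex_linear_vimage linear_component_sum) auto
  then have "convex {x :: real ^ ('a set). (\<Sum>e\<in>E. x $ e) = 2}"
    by (simp add: vimage_def)
  then show ?thesis unfolding hypersimplex2_def
    by (intro convex_Int convex_edge_space convex_box) auto
qed

lemma mem_hypersimplex2: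
  "x \<in> hypersimplex2 E \<longleftrightarrow>
    (\<forall>e. e \<notin> E \<longrightarrow> x $ e = 0) \<and> (\<forall>e. 0 \<le> x $ e \<and> x $ e \<le> 1) \<and> (\<Sum>e\<in>E. x $ e) = 2"
  by (auto simp: hypersimplex2_def edge_space_def mem_box_cart)

text \<open>
  A fractional entry of an extreme point would, by integrality of the coordinate sum, come with a
  second one, and shifting weight between the two in both directions contradicts extremality.
\<close>

lemma extreme_point_hypersimplex2_integral:
  assumes ext: "x extreme_point_of hypersimplex2 E"
  shows "x $ e \<in> {0, 1}"
proof (rule ccontr)
  assume fe: "x $ e \<notin> {0, 1}"
  have xH: "x \<in> hypersimplex2 E" using ext by (simp add: extreme_point_of_def)
  then have x: "\<And>e. e \<notin> E \<Longrightarrow> x $ e = 0" "\<And>e. 0 \<le> x $ e" "\<And>e. x $ e \<le> 1" "(\<Sum>e\<in>E. x $ e) = 2"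
    by (auto simp: mem_hypersimplex2)
  have eE: "e \<in> E" using fe x(1) by auto
  have "\<exists>f\<in>E - {e}. x $ f \<notin> {0, 1}"
  proof (rule ccontr)
    assume "\<not> ?thesis"
    then have "x $ f \<in> \<int>" if "f \<in> E - {e}" for f
      using that by (metis Ints_0 Ints_1 insert_iff singletonD)
    then have "(\<Sum>f\<in>E - {e}. x $ f) \<in> \<int>" by (intro Ints_sum)
    moreover have "x $ e = 2 - (\<Sum>f\<in>E - {e}. x $ f)"
      using x(4) eE by (simp add: sum.remove)
    ultimately have "x $ e \<in> \<int>" by auto
    then obtain k where "x $ e = of_int k" by (auto elim: Ints_cases)
    moreover have "0 < x $ e" "x $ e < 1" using fe x(2)[of e] x(3)[of e] by auto
    ultimately show False by simp
  qed
  then obtain f where f: "f \<in> E" "f \<noteq> e" "x $ f \<notin> {0, 1}" by auto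
  \<comment> \<open>The largest amount by which both entries can move up and down within the unit
    interval.\<close>
  define d where "d = min (min (x $ e) (1 - x $ e)) (min (x $ f) (1 - x $ f))"
  have d0: "0 < d" using fe f x(2)[of e] x(3)[of e] x(2)[of f] x(3)[of f] by (auto simp: d_def)
  have d: "d \<le> x $ e" "d \<le> 1 - x $ e" "d \<le> x $ f" "d \<le> 1 - x $ f" by (auto simp: d_def)
  define w :: "real ^ ('a set)" where "w = axis e d - axis f d"
  have w: "w $ e = d" "w $ f = - d" "\<And>g. g \<noteq> e \<Longrightarrow> g \<noteq> f \<Longrightarrow> w $ g = 0"
    using f by (auto simp: w_def axis_def)
  have sw: "(\<Sum>g\<in>E. w $ g) = 0"
  proof -
    have "(\<Sum>g\<in>E. w $ g) = (\<Sum>g\<in>{e, f}. w $ g)"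
      using eE f w(3) by (intro sum.mono_neutral_right) auto
    then show ?thesis using f w by simp
  qed
  have "x + s *\<^sub>R w \<in> hypersimplex2 E" if "s = 1 \<or> s = -1" for s
  proof -
    have "0 \<le> (x + s *\<^sub>R w) $ g \<and> (x + s *\<^sub>R w) $ g \<le> 1" for g
    proof (cases "g = e \<or> g = f")
      case True
      then show ?thesis using that w d d0 by auto
    next
      case False
      then show ?thesis using w(3)[of g] x(2,3)[of g] by auto
    qed
    moreover have "(x + s *\<^sub>R w) $ g = 0" if "g \<notin> E" for g
      using that eE f w(3)[of g] x(1)[of g] by auto
    moreover have "(\<Sum>g\<in>E. (x + s *\<^sub>R w) $ g) = 2"
      using x(4) sw by (simp add: sum.distrib flip: sum_distrib_left)
    ultimately show ?thesis by (simp add: mem_hypersimplex2)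
  qed
  from this[of 1] this[of "-1"] have pm: "x + w \<in> hypersimplex2 E" "x - w \<in> hypersimplex2 E" by auto
  have "(x + w) $ e \<noteq> (x - w) $ e" using w(1) d0 by simp
  then have "x + w \<noteq> x - w" by metis
  moreover have "x = midpoint (x + w) (x - w)" by (simp add: midpoint_def flip: scaleR_2)
  ultimately have "x \<in> open_segment (x + w) (x - w)" by (metis midpoint_in_open_segment)
  then show False using ext pm by (auto simp: extreme_point_of_def)
qed

text \<open>By Krein-Milman it suffices to treat extreme points. An integral one is the incidence
  vector of its support, and coordinate sum 2 makes the support a pair.\<close>

lemma hypersimplex2_subset: "hypersimplex2 E \<subseteq> convex hull (pair_vectors E)"
proof -
  have "x \<in> pair_vectors E" if ext: "x extreme_point_of hypersimplex2 E" for x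
  proof -
    have xH: "x \<in> hypersimplex2 E" using ext by (simp add: extreme_point_of_def)
    define D where "D = {e. x $ e = 1}"
    have xD: "x = incidence_vector D"
      using extreme_point_hypersimplex2_integral[OF ext]
      by (auto simp: vec_eq_iff incidence_vector_def D_def)
    have DE: "D \<subseteq> E" using xH by (auto simp: D_def mem_hypersimplex2)
    have "real (card D) = 2"
      using xH sum_incidence_vector[OF DE] by (simp add: mem_hypersimplex2 flip: xD)
    then have "card D = 2" by simp
    then show ?thesis using DE xD by (auto simp: pair_vectors_def)
  qed
  then have "convex hull {x. x extreme_point_of hypersimplex2 E} \<subseteq> convex hull (pair_vectors E)"
    by (intro hull_mono) auto
  then show ?thesis
    using Krein_Milman_Minkowski[OF compact_hypersimplex2 convex_hypersimplex2, of E] by simp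
qed

section \<open>The inequality description of the hull of the origin and the pairs\<close>

definition bond_inequalities :: "'v::finite set set \<Rightarrow> (real ^ ('v set)) set" where
  "bond_inequalities E = {x \<in> edge_space E.
         (\<forall>e\<in>E. - x $ e \<le> 0) \<and>
         (\<forall>e\<in>E. x $ e - (\<Sum>f\<in>E - {e}. x $ f) \<le> 0) \<and>
         (\<Sum>e\<in>E. x $ e) \<le> 2}"

text \<open>Puts all cycle inequalities into the form \<open>2 * x $ e \<le> s\<close> with the same
  total \<open>s\<close>.\<close>

lemma sum_others:
  fixes x :: "real ^ 'i::finite"
  assumes "e \<in> E"
  shows "x $ e - (\<Sum>f\<in>E - {e}. x $ f) = 2 * x $ e - (\<Sum>f\<in>E. x $ f)"
  using assms by (simp add: sum.remove)

text \<open>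
  For a point with coordinate sum \<open>s\<close> the cycle inequalities say that no entry exceeds \<open>s / 2\<close>;
  scaling by \<open>2 / s\<close> therefore lands in the hypersimplex.
\<close>

lemma bond_inequalities_subset: "bond_inequalities E \<subseteq> convex hull (insert 0 (pair_vectors E))"
proof
  fix x assume "x \<in> bond_inequalities E"
  then have x: "\<And>e. e \<notin> E \<Longrightarrow> x $ e = 0" "\<And>e. e \<in> E \<Longrightarrow> 0 \<le> x $ e"
      "\<And>e. e \<in> E \<Longrightarrow> 2 * x $ e \<le> (\<Sum>f\<in>E. x $ f)" "(\<Sum>e\<in>E. x $ e) \<le> 2"
    by (auto simp: bond_inequalities_def edge_space_def sum_others)
  define s where "s = (\<Sum>e\<in>E. x $ e)"
  have s0: "0 \<le> s" unfolding s_def using x(2) by (intro sum_nonneg)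
  let ?C = "convex hull (insert 0 (pair_vectors E))"
  have z: "0 \<in> ?C" by (intro hull_inc) simp
  show "x \<in> ?C"
  proof (cases "s = 0")
    case True
    then have "x $ e = 0" for e using x(1)[of e] x(2)[of e] x(3)[of e] by (cases "e \<in> E") (auto simp: s_def)
    then have "x = 0" by (simp add: vec_eq_iff)
    then show ?thesis using z by simp
  next
    case False
    then have s: "0 < s" using s0 by simp
    let ?y = "(2 / s) *\<^sub>R x"
    have "0 \<le> ?y $ e \<and> ?y $ e \<le> 1" for e
      using s x(1)[of e] x(2)[of e] x(3)[of e] by (cases "e \<in> E") (auto simp: field_simps s_def)
    moreover have "(\<Sum>e\<in>E. ?y $ e) = 2"
      using s by (simp add: s_def flip: sum_distrib_left sum_divide_distrib)
    ultimately have "?y \<in> hypersimplex2 E" using x(1) by (simp add: mem_hypersimplex2)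
    then have "?y \<in> convex hull (pair_vectors E)" using hypersimplex2_subset by blast
    then have "?y \<in> ?C" using hull_mono[of "pair_vectors E" "insert 0 (pair_vectors E)" convex] by blast
    \<comment> \<open>This combination equals \<open>x\<close>; the bound \<open>s \<le> 2\<close>
      makes the weight of the origin nonnegative.\<close>
    then have "(1 - s / 2) *\<^sub>R 0 + (s / 2) *\<^sub>R ?y \<in> ?C"
      using z s x(4) by (intro convexD[OF convex_convex_hull]) (auto simp: s_def)
    then show ?thesis using s by simp
  qed
qed

lemma linear_component_diff: "linear (\<lambda>x :: real ^ 'i::finite. x $ e - (\<Sum>f\<in>A. x $ f))"
  by (intro linearI) (auto simp: sum.distrib sum_distrib_left algebra_simps)

lemma linear_component_minus: "linear (\<lambda>x :: real ^ 'i::finite. - x $ e)"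
  by (intro linearI) auto

lemma convex_sublevel_linear:
  fixes f :: "'a::real_vector \<Rightarrow> real"
  assumes "linear f"
  shows "convex {x. f x \<le> b}"
  using convex_linear_vimage[OF assms, of "{..b}"] by (simp add: vimage_def)

lemma convex_bond_inequalities: "convex (bond_inequalities E)"
proof -
  have "bond_inequalities E = edge_space E \<inter> (\<Inter>e\<in>E. {x. - x $ e \<le> 0}) \<inter>
     (\<Inter>e\<in>E. {x. x $ e - (\<Sum>f\<in>E - {e}. x $ f) \<le> 0}) \<inter> {x. (\<Sum>e\<in>E. x $ e) \<le> 2}"
    by (auto simp: bond_inequalities_def)
  also have "convex \<dots>"
    by (intro convex_Int convex_INT convex_edge_space convex_sublevel_linear
      linear_component_sum linear_component_diff linear_component_minus)
  finally show ?thesis .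
qed

text \<open>A pair has coordinate sum 2 and entries at most 1, which gives the cycle inequalities
  through \<open>sum_others\<close>.\<close>

lemma pair_vectors_subset_bond_inequalities: "insert 0 (pair_vectors E) \<subseteq> bond_inequalities E"
proof -
  have "incidence_vector D \<in> bond_inequalities E" if D: "D \<subseteq> E" "card D = 2" for D
  proof -
    have "(\<Sum>e\<in>E. incidence_vector D $ e) = 2" using sum_incidence_vector[OF D(1)] D by simp
    then show ?thesis using D
      by (auto simp: bond_inequalities_def sum_others edge_space_def) (auto simp: incidence_vector_def)
  qed
  moreover have "0 \<in> bond_inequalities E" by (simp add: bond_inequalities_def edge_space_def)
  ultimately show ?thesis by (auto simp: pair_vectors_def)
qed

lemma convex_hull_pair_vectors: "convex hull (insert 0 (pair_vectors E)) = bond_inequalities E"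
  by (intro equalityI bond_inequalities_subset hull_minimal
    pair_vectors_subset_bond_inequalities convex_bond_inequalities)

section \<open>Facets\<close>

text \<open>A dimension count. \<open>P\<close> has dimension at most \<open>card E\<close>, while
  the face together with \<open>v\<close> spans all axes of \<open>E\<close>, so the face has
  dimension at least \<open>card E - 1\<close>. It is a proper face because it misses
  \<open>v\<close>. \<open>F\<close> is any convenient set of points on the face.\<close>

lemma facet_definingI:
  fixes E :: "'v::finite set set" and P :: "(real ^ ('v set)) set"
  assumes P: "convex P" "P \<subseteq> edge_space E"
    and f: "linear f" "\<And>x. x \<in> P \<Longrightarrow> f x \<le> b"
    and v: "v \<in> P" "f v \<noteq> b" and "0 \<in> P" "f 0 = b \<or> v = 0"
    and F: "F \<noteq> {}" "F \<subseteq> {x \<in> P. f x = b}"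
    and axes: "\<And>e. e \<in> E \<Longrightarrow> axis e 1 \<in> span (insert v F)"
  shows "facet_defining P f b"
proof -
  let ?F = "{x \<in> P. f x = b}"
  \<comment> \<open>The normal vector of the supporting hyperplane is the adjoint of
    \<open>f\<close> applied to 1.\<close>
  have inner: "f x = adjoint f 1 \<bullet> x" for x
    using adjoint_works[OF f(1), of x 1] by (simp add: inner_commute)
  have "P \<inter> {x. adjoint f 1 \<bullet> x = b} face_of P"
    using P(1) f(2) by (intro face_of_Int_supporting_hyperplane_le) (auto simp: inner)
  moreover have "P \<inter> {x. adjoint f 1 \<bullet> x = b} = ?F" by (auto simp: inner)
  ultimately have face: "?F face_of P" by simp
  have "?F \<noteq> P" using v by auto
  then have lt: "aff_dim ?F < aff_dim P" using face_of_aff_dim_lt[OF P(1) face] by simp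
  let ?A = "(\<lambda>e. axis e (1::real)) ` E :: (real ^ ('v set)) set"
  have cA: "card ?A = card E" by (intro card_image) (auto simp: inj_on_def axis_eq_axis)
  have "P \<subseteq> span ?A"
  proof
    fix x assume "x \<in> P"
    then have xE: "x \<in> edge_space E" using P by auto
    have "x = (\<Sum>e\<in>UNIV. x $ e *\<^sub>R axis e 1)"
      using basis_expansion[of x] by (simp add: scalar_mult_eq_scaleR)
    also have "\<dots> = (\<Sum>e\<in>E. x $ e *\<^sub>R axis e 1)"
      using xE by (intro sum.mono_neutral_right) (auto simp: edge_space_def)
    also have "\<dots> \<in> span ?A" by (intro span_sum span_scale span_base) auto
    finally show "x \<in> span ?A" .
  qed
  then have "aff_dim P \<le> aff_dim (span ?A)" by (rule aff_dim_subset)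
  also have "\<dots> = int (dim ?A)" by (simp add: aff_dim_subspace)
  also have "\<dots> \<le> int (card E)" using dim_le_card'[of ?A] cA by simp
  finally have upper: "aff_dim P \<le> int (card E)" .
  have "independent ?A"
    by (rule independent_mono[OF independent_Basis]) (auto simp: Basis_vec_def)
  moreover have "?A \<subseteq> span (insert v ?F)"
    using axes span_mono[of "insert v F" "insert v ?F"] F by blast
  ultimately have "card E \<le> dim (insert v ?F)"
    using independent_card_le_dim[of ?A "span (insert v ?F)"] cA by simp
  \<comment> \<open>The disjunction \<open>f 0 = b \<or> v = 0\<close> serves here: once the origin
    is present, affine and linear dimension agree.\<close>
  moreover have "0 \<in> insert v ?F" using assms by auto
  ultimately have "int (card E) \<le> aff_dim (insert v ?F)"
    by (simp add: aff_dim_zero hull_inc)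
  also have "\<dots> \<le> aff_dim ?F + 1" by (simp add: aff_dim_insert)
  finally have "aff_dim ?F = aff_dim P - 1" using lt upper by simp
  moreover have "?F \<noteq> {}" using F by blast
  ultimately show ?thesis using f face by (simp add: facet_defining_def facet_of_def)
qed

lemma incidence_vector_pair:
  "e \<noteq> f \<Longrightarrow> incidence_vector {e, f} = axis e 1 + axis f 1"
  by (auto simp: vec_eq_iff incidence_vector_def axis_def)

text \<open>The two sums containing \<open>e\<close> minus the third sum give twice
  \<open>axis e 1\<close>.\<close>

lemma axis_in_span_triangle:
  fixes e f g :: "'i::finite"
  assumes "axis e 1 + axis f 1 \<in> span X" "axis e 1 + axis g 1 \<in> span X" "axis f 1 + axis g 1 \<in> span X"
  shows "axis e (1::real) \<in> span X"
proof -
  have "axis e (1::real) =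
    (1/2) *\<^sub>R ((axis e 1 + axis f 1) + (axis e 1 + axis g 1) - (axis f 1 + axis g 1))"
    by (simp add: vec_eq_iff)
  then show ?thesis using assms by (metis span_scale span_add span_diff)
qed

text \<open>Facets from nonnegativity are claimed only for \<open>n \<ge> 4\<close>; the triangle is
  ruled out by \<open>nonneg_not_facet_defining_triangle\<close>.\<close>

theorem theorem6p8:
  fixes n :: nat and V :: "'v::finite set" and E :: "'v set set"
  assumes "n \<ge> 3" and "cycle_graph n V E"
  shows "bond_polytope V E =
      {x \<in> edge_space E.
         (\<forall>e\<in>E. - x $ e \<le> 0) \<and>
         (\<forall>e\<in>E. x $ e - (\<Sum>f\<in>E - {e}. x $ f) \<le> 0) \<and>
         (\<Sum>e\<in>E. x $ e) \<le> 2} \<and>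
    (n \<ge> 4 \<longrightarrow> (\<forall>e\<in>E. facet_defining (bond_polytope V E) (\<lambda>x. - x $ e) 0)) \<and>
    (\<forall>e\<in>E. facet_defining (bond_polytope V E) (\<lambda>x. x $ e - (\<Sum>f\<in>E - {e}. x $ f)) 0) \<and>
    facet_defining (bond_polytope V E) (\<lambda>x. \<Sum>e\<in>E. x $ e) 2"
proof -
  obtain c where "cycle_labelling n c V E"
    using assms by (auto simp: cycle_graph_def cycle_labelling_def)
  then interpret cycle_labelling n c V E .
  let ?P = "bond_polytope V E"
  have "incidence_vector {} = (0 :: real ^ ('v set))"
    by (simp add: incidence_vector_def vec_eq_iff)
  then have "?P = convex hull (insert 0 (pair_vectors E))"
    by (simp add: bond_polytope_def bonds_eq pair_vectors_def)
  then have P: "?P = bond_inequalities E" by (simp add: convex_hull_pair_vectors)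
  have cvx: "convex ?P" by (simp add: P convex_bond_inequalities)
  have sub: "?P \<subseteq> edge_space E" by (auto simp: P bond_inequalities_def)
  have zero: "0 \<in> ?P" using pair_vectors_subset_bond_inequalities P by blast
  let ?p = "\<lambda>e f. axis e 1 + axis f 1 :: real ^ ('v set)"
  have pair: "?p e f \<in> ?P" if "e \<in> E" "f \<in> E" "e \<noteq> f" for e f
  proof -
    have "incidence_vector {e, f} \<in> pair_vectors E"
      using that by (auto simp: pair_vectors_def)
    then show ?thesis
      using pair_vectors_subset_bond_inequalities[of E] P that by (auto simp: incidence_vector_pair)
  qed
  have sum_pair: "(\<Sum>g\<in>E. ?p e f $ g) = 2" if "e \<in> E" "f \<in> E" "e \<noteq> f" for e f
    using sum_incidence_vector[of "{e, f}" E] that by (simp add: incidence_vector_pair)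
  \<comment> \<open>Supplies the two auxiliary edges, away from \<open>A\<close>, that complete a
    triangle of pairs.\<close>
  have two_others: "\<exists>f g. f \<in> E - A \<and> g \<in> E - A \<and> f \<noteq> g" if "card A + 2 \<le> n" for A
  proof -
    have "2 \<le> card (E - A)" using that card_edges diff_card_le_card_Diff[of A E] by simp
    then obtain B where "B \<subseteq> E - A" "card B = 2" by (metis obtain_subset_with_card_n)
    then show ?thesis by (auto simp: card_2_iff)
  qed
  have nonneg: "facet_defining ?P (\<lambda>x. - x $ e) 0" if n4: "n \<ge> 4" and e: "e \<in> E" for e
  proof -
    define F where "F = {?p f g | f g. f \<in> E - {e} \<and> g \<in> E - {e} \<and> f \<noteq> g}"
    obtain f where f: "f \<in> E - {e}" using two_others[of "{e}"] n4 by auto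
    have others: "axis g 1 \<in> span (insert (?p e f) F)" if g: "g \<in> E - {e}" for g
    proof -
      have "card {e, g} = 2" using g by (intro card_2_iff[THEN iffD2]) blast
      \<comment> \<open>Here \<open>n \<ge> 4\<close> enters: a triangle of pairs through
        \<open>g\<close> that avoids \<open>e\<close> needs two edges besides \<open>e\<close> and
        \<open>g\<close>.\<close>
      then obtain h k where hk: "h \<in> E - {e, g}" "k \<in> E - {e, g}" "h \<noteq> k"
        using two_others[of "{e, g}"] n4 by auto
      show ?thesis
        by (rule axis_in_span_triangle[of _ h _ k]; intro span_base) (use hk that in \<open>auto simp: F_def\<close>)
    qed
    show ?thesis
    proof (rule facet_definingI[OF cvx sub linear_component_minus, where v = "?p e f" and F = F])
      show "F \<noteq> {}" using two_others[of "{e}"] n4 by (auto simp: F_def)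
      show "F \<subseteq> {x \<in> ?P. - x $ e = 0}" using pair by (auto simp: F_def axis_def)
      show "?p e f \<in> ?P" using pair e f by auto
      show "- ?p e f $ e \<noteq> 0" using f by (auto simp: axis_def)
      show "axis g 1 \<in> span (insert (?p e f) F)" if "g \<in> E" for g
      proof (cases "g = e")
        case True
        have "?p e f - axis f 1 \<in> span (insert (?p e f) F)"
          by (intro span_diff others f) (simp add: span_base)
        then show ?thesis using True by simp
      qed (use others that in auto)
    qed (use zero e in \<open>auto simp: P bond_inequalities_def\<close>)
  qed
  have cyc: "facet_defining ?P (\<lambda>x. x $ e - (\<Sum>f\<in>E - {e}. x $ f)) 0" if e: "e \<in> E" for e
  proof -
    \<comment> \<open>Pairs through \<open>e\<close> give equality, whereas a pair avoiding
      \<open>e\<close> gives the value -2 and can serve as \<open>v\<close>. Its triangle with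
      \<open>e\<close> yields \<open>axis e 1\<close>, and subtracting this from the pairs through
      \<open>e\<close> yields the other axes.\<close>
    define F where "F = insert 0 {?p e f | f. f \<in> E - {e}}"
    obtain f g where fg: "f \<in> E - {e}" "g \<in> E - {e}" "f \<noteq> g"
      using two_others[of "{e}"] n3 by auto
    have ae: "axis e 1 \<in> span (insert (?p f g) F)"
      by (rule axis_in_span_triangle[of _ f _ g]; intro span_base) (use fg in \<open>auto simp: F_def\<close>)
    show ?thesis
    proof (rule facet_definingI[OF cvx sub linear_component_diff, where v = "?p f g" and F = F])
      show "F \<subseteq> {x \<in> ?P. x $ e - (\<Sum>f\<in>E - {e}. x $ f) = 0}"
        using pair zero e sum_pair unfolding F_def sum_others[OF e] by (auto simp: axis_def)
      show "?p f g \<in> ?P" using pair fg by auto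
      show "?p f g $ e - (\<Sum>h\<in>E - {e}. ?p f g $ h) \<noteq> 0"
        unfolding sum_others[OF e] using sum_pair[of f g] fg by (auto simp: axis_def)
      show "axis h 1 \<in> span (insert (?p f g) F)" if "h \<in> E" for h
      proof (cases "h = e")
        case False
        then have "?p e h - axis e 1 \<in> span (insert (?p f g) F)"
          using that by (intro span_diff ae span_base) (auto simp: F_def)
        then show ?thesis by simp
      qed (use ae in simp)
    qed (use zero e in \<open>auto simp: P bond_inequalities_def F_def\<close>)
  qed
  have total: "facet_defining ?P (\<lambda>x. \<Sum>e\<in>E. x $ e) 2"
  proof -
    \<comment> \<open>All pairs lie on this face and the origin does not, so the origin itself is
      the extra point \<open>v\<close>.\<close>
    define F where "F = {?p f g | f g. f \<in> E \<and> g \<in> E \<and> f \<noteq> g}"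
    show ?thesis
    proof (rule facet_definingI[OF cvx sub linear_component_sum, where v = 0 and F = F])
      show "F \<noteq> {}" using two_others[of "{}"] n3 by (auto simp: F_def)
      show "F \<subseteq> {x \<in> ?P. (\<Sum>e\<in>E. x $ e) = 2}"
        using pair sum_pair by (auto simp only: F_def)
      show "axis g 1 \<in> span (insert 0 F)" if "g \<in> E" for g
      proof -
        obtain h k where hk: "h \<in> E - {g}" "k \<in> E - {g}" "h \<noteq> k"
          using two_others[of "{g}"] n3 by auto
        show ?thesis
          by (rule axis_in_span_triangle[of _ h _ k]; intro span_base) (use hk that in \<open>auto simp: F_def\<close>)
      qed
    qed (use zero in \<open>auto simp: P bond_inequalities_def\<close>)
  qed
  show ?thesis
    using nonneg cyc total P unfolding bond_inequalities_def by blast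
qed

end
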